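(* For $p\in[2,\infty)$ let $$K(p)=\sup_n\ \sup_{\{\xi(i)\}}\ \frac{\left|n^{-1/2}S(n)\right|_p}{\left\{n^{-1}\sum_{i=1}^n|\xi(i)|_p^2\right\}^{1/2}},\qquad S(n)=\sum_{i=1}^n\xi(i),$$ where the outer supremum is over integers $n\ge1$ and the inner one is over all sequences $\{\xi(i)\}$ of centered martingale differences belonging to $L(p)$ (on arbitrary probability spaces with arbitrary filtrations) for which the denominator is nonzero. Then $$\sup_{p\in[2,\infty)}\frac{K(p)}{p-1}=1.$$
   Context: For a real random variable $\eta$ and $p\in[1,\infty)$, $|\eta|_p=({\bf E}|\eta|^p)^{1/p}$, and $L(p)$ is the set of $\eta$ with $|\eta|_p<\infty$. Centered martingale differences with respect to a filtration $\{F(i)\}$ on a probability space $(\Omega,F,{\bf P})$, where $F(0)=\{\emptyset,\Omega\}$ and $F(i)\subset F(i+1)\subset F$, are integrable real random variables $\xi(i)$ such that ${\bf E}\xi(i)=0$, $\xi(i)$ is $F(i)$-measurable, and ${\bf E}(\xi(i)\mid F(k))=0$ almost surely for all $0\le k\le i-1$. *)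

theory Defs
  imports "HOL-Probability.Probability"
begin

definition Lp_norm :: "'a measure \<Rightarrow> real \<Rightarrow> ('a \<Rightarrow> real) \<Rightarrow> real" where
  "Lp_norm M p \<eta> = (LINT x|M. \<bar>\<eta> x\<bar> powr p) powr (1 / p)"

definition Lp_space :: "'a measure \<Rightarrow> real \<Rightarrow> ('a \<Rightarrow> real) set" where
  "Lp_space M p = {\<eta> \<in> borel_measurable M. integrable M (\<lambda>x. \<bar>\<eta> x\<bar> powr p)}"

text \<open>
  A filtration is a family of measures \<open>F i\<close> of which only the space and the
  \<open>\<sigma>\<close>-algebra \<open>sets (F i)\<close> matter.  The differences are \<open>\<xi> 1, \<xi> 2, \<dots>\<close>;
  \<open>\<xi> 0\<close> is an unused junk value.
\<close>

definition centered_martingale_differences ::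
  "'a measure \<Rightarrow> (nat \<Rightarrow> 'a measure) \<Rightarrow> (nat \<Rightarrow> 'a \<Rightarrow> real) \<Rightarrow> bool" where
  "centered_martingale_differences M F \<xi> \<longleftrightarrow>
     filtration (space M) F \<and> (\<forall>i. subalgebra M (F i)) \<and> sets (F 0) = {{}, space M} \<and>
     (\<forall>i\<ge>1. integrable M (\<xi> i) \<and> (LINT x|M. \<xi> i x) = 0 \<and> \<xi> i \<in> borel_measurable (F i) \<and>
        (\<forall>k\<le>i - 1. AE x in M. real_cond_exp M (F k) (\<xi> i) x = 0))"

definition S :: "(nat \<Rightarrow> 'a \<Rightarrow> real) \<Rightarrow> nat \<Rightarrow> 'a \<Rightarrow> real" where
  "S \<xi> n x = (\<Sum>i=1..n. \<xi> i x)"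

definition numerator :: "'a measure \<Rightarrow> real \<Rightarrow> (nat \<Rightarrow> 'a \<Rightarrow> real) \<Rightarrow> nat \<Rightarrow> real" where
  "numerator M p \<xi> n = Lp_norm M p (\<lambda>x. real n powr (- 1 / 2) * S \<xi> n x)"

definition denominator :: "'a measure \<Rightarrow> real \<Rightarrow> (nat \<Rightarrow> 'a \<Rightarrow> real) \<Rightarrow> nat \<Rightarrow> real" where
  "denominator M p \<xi> n = sqrt ((\<Sum>i=1..n. (Lp_norm M p (\<xi> i))\<^sup>2) / real n)"

text \<open>
  A supremum over probability spaces of all types cannot be written down in HOL, so the type
  \<open>'a\<close> of sample points is a parameter.  Lemma \<open>K_le_K\<close> below shows that
  \<open>K TYPE('a) p\<close> bounds the ratios on probability spaces over every type \<open>'b\<close>, hence is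
  the supremum over all probability spaces, as soon as \<open>'a\<close> has at least the cardinality
  of \<open>nat \<Rightarrow> real\<close>, i.e. of the continuum.
\<close>

definition K :: "'a itself \<Rightarrow> real \<Rightarrow> ereal" where
  "K _ p = (SUP n\<in>{1..}. Sup {ereal (numerator M p \<xi> n / denominator M p \<xi> n) | (M :: 'a measure) F \<xi>.
     prob_space M \<and> centered_martingale_differences M F \<xi> \<and>
     (\<forall>i\<ge>1. \<xi> i \<in> Lp_space M p) \<and> denominator M p \<xi> n \<noteq> 0})"

text \<open>
  The law of the sequence \<open>\<xi>\<close>, transported along an injection \<open>f\<close> into \<open>'a\<close>, with its
  natural filtration.
\<close>

lemma martingale_differences_transfer:
  fixes M :: "'b measure" and f :: "(nat \<Rightarrow> real) \<Rightarrow> 'a"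
  assumes f: "inj f" and M: "prob_space M"
    and mds: "centered_martingale_differences M F \<xi>"
    and Lp: "\<forall>i\<ge>1. \<xi> i \<in> Lp_space M p"
  obtains N :: "'a measure" and G and \<zeta> where
    "prob_space N" "centered_martingale_differences N G \<zeta>" "\<forall>i\<ge>1. \<zeta> i \<in> Lp_space N p"
    "\<And>n. numerator N p \<zeta> n = numerator M p \<xi> n"
    "\<And>n. denominator N p \<zeta> n = denominator M p \<xi> n"
proof -
  interpret prob_space M by (rule M)
  define P :: "nat set \<Rightarrow> (nat \<Rightarrow> real) measure" where "P = (\<lambda>I. PiM I (\<lambda>_. borel))"
  define g where "g = inv f"
  have gf: "g (f u) = u" for u unfolding g_def using f by simp
  define h where "h = (\<lambda>x. f (\<lambda>i. if i = 0 then 0 else \<xi> i x))"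
  define \<zeta> where "\<zeta> = (\<lambda>i y. if i = 0 then 0 else g y i)"
  define G where "G = (\<lambda>k. vimage_algebra UNIV (\<lambda>y. restrict (g y) {1..k}) (P {1..k}))"
  define H where "H = vimage_algebra UNIV g (P UNIV)"
  define N where "N = distr M H h"
  have filt: "filtration (space M) F" and sub: "\<And>i. subalgebra M (F i)"
    and int: "\<And>i. i \<ge> 1 \<Longrightarrow> integrable M (\<xi> i)"
    and mean: "\<And>i. i \<ge> 1 \<Longrightarrow> (LINT x|M. \<xi> i x) = 0"
    and adapt: "\<And>i. i \<ge> 1 \<Longrightarrow> \<xi> i \<in> borel_measurable (F i)"
    and ce: "\<And>i k. i \<ge> 1 \<Longrightarrow> k \<le> i - 1 \<Longrightarrow> AE x in M. real_cond_exp M (F k) (\<xi> i) x = 0"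
    using mds unfolding centered_martingale_differences_def by auto
  have spF: "space (F k) = space M" for k using sub[of k] by (simp add: subalgebra_def)
  have monoF: "i \<le> j \<Longrightarrow> sets (F i) \<subseteq> sets (F j)" for i j
    using filtration.sets_F_mono[OF filt] .
  have adapt': "\<xi> i \<in> borel_measurable (F k)" if "1 \<le> i" "i \<le> k" for i k
    using adapt[OF that(1)] monoF[OF that(2)] spF[of i] spF[of k]
    by (auto simp: measurable_def)
  have \<zeta>h: "\<zeta> i (h x) = \<xi> i x" if "i \<ge> 1" for i x
    using that by (simp add: \<zeta>_def h_def gf)
  have gH: "g \<in> H \<rightarrow>\<^sub>M P UNIV"
    unfolding H_def by (rule measurable_vimage_algebra1) (auto simp: P_def space_PiM)
  have \<xi>M: "\<xi> i \<in> borel_measurable M" if "i \<ge> 1" for i using int[OF that] by auto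
  have \<xi>0: "(\<lambda>x. if i = 0 then 0 else \<xi> i x) \<in> borel_measurable M" for i
    using \<xi>M[of i] by (cases "i = 0") auto
  have hH: "h \<in> M \<rightarrow>\<^sub>M H" unfolding H_def
  proof (rule measurable_vimage_algebra2)
    show "(\<lambda>x. g (h x)) \<in> M \<rightarrow>\<^sub>M P UNIV"
      unfolding h_def gf P_def
      by (rule measurable_PiM_single') (auto intro: \<xi>0)
  qed auto
  have comp: "(\<lambda>u. u i) \<in> borel_measurable (P I)" if "i \<in> I" for i I
    unfolding P_def using that by (rule measurable_component_singleton)
  have \<zeta>H: "\<zeta> i \<in> borel_measurable H" for i
    unfolding \<zeta>_def using measurable_compose[OF gH comp[of i UNIV]] by simp
  have \<zeta>N: "\<zeta> i \<in> borel_measurable N" for i using \<zeta>H by (simp add: N_def)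
  have spG: "space (G k) = UNIV" for k by (simp add: G_def)
  have spN: "space N = UNIV" by (simp add: N_def H_def)
  have setsN: "sets N = sets H" by (simp add: N_def)
  have restrG: "(\<lambda>y. restrict (g y) {1..k}) \<in> G k \<rightarrow>\<^sub>M P {1..k}" for k
    unfolding G_def by (rule measurable_vimage_algebra1) (auto simp: P_def space_PiM)
  have \<zeta>G: "\<zeta> i \<in> borel_measurable (G k)" if "1 \<le> i" "i \<le> k" for i k
  proof -
    have "(\<lambda>y. restrict (g y) {1..k} i) \<in> borel_measurable (G k)"
      by (rule measurable_compose[OF restrG comp]) (use that in auto)
    then show ?thesis using that by (simp add: \<zeta>_def)
  qed
  have idG: "(\<lambda>y. y) \<in> L \<rightarrow>\<^sub>M G k"
    if "space L = UNIV" "\<And>i. 1 \<le> i \<Longrightarrow> i \<le> k \<Longrightarrow> \<zeta> i \<in> borel_measurable L" for L k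
    unfolding G_def
  proof (rule measurable_vimage_algebra2)
    show "(\<lambda>y. restrict (g y) {1..k}) \<in> L \<rightarrow>\<^sub>M P {1..k}"
      unfolding P_def
    proof (rule measurable_restrict)
      fix i assume "i \<in> {1..k}"
      then show "(\<lambda>y. g y i) \<in> borel_measurable L" using that(2)[of i] by (simp add: \<zeta>_def)
    qed
  qed auto
  have subG: "sets (G k) \<subseteq> sets L"
    if "space L = UNIV" "\<And>i. 1 \<le> i \<Longrightarrow> i \<le> k \<Longrightarrow> \<zeta> i \<in> borel_measurable L" for L k
    using measurable_sets[OF idG[OF that]] that(1) by auto
  have subalgG: "subalgebra N (G k)" for k
    unfolding subalgebra_def using subG[OF spN] \<zeta>N spG spN by auto
  have hF: "h \<in> F k \<rightarrow>\<^sub>M G k" for k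
    unfolding G_def
  proof (rule measurable_vimage_algebra2)
    show "(\<lambda>x. restrict (g (h x)) {1..k}) \<in> F k \<rightarrow>\<^sub>M P {1..k}"
      unfolding P_def
    proof (rule measurable_restrict)
      fix i assume "i \<in> {1..k}"
      then show "(\<lambda>x. g (h x) i) \<in> borel_measurable (F k)"
        using adapt'[of i k] by (simp add: h_def gf)
    qed
  qed auto
  have probN: "prob_space N" unfolding N_def by (rule prob_space_distr[OF hH])
  then interpret N: prob_space N .
  have LINT: "(LINT y|N. q y) = (LINT x|M. q (h x))" if "q \<in> borel_measurable H" for q :: "'a \<Rightarrow> real"
    unfolding N_def by (rule integral_distr[OF hH that])
  have integ: "integrable N q \<longleftrightarrow> integrable M (\<lambda>x. q (h x))"
    if "q \<in> borel_measurable H" for q :: "'a \<Rightarrow> real"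
    unfolding N_def by (rule integrable_distr_eq[OF hH that])
  have intN: "integrable N (\<zeta> i)" if "i \<ge> 1" for i
    using integ[OF \<zeta>H] int[OF that] by (simp add: \<zeta>h[OF that])
  have ceN: "AE y in N. real_cond_exp N (G k) (\<zeta> i) y = 0" if ik: "i \<ge> 1" "k \<le> i - 1" for i k
  proof -
    interpret FM: finite_measure_subalgebra M "F k"
      by unfold_locales (rule sub)
    interpret GN: finite_measure_subalgebra N "G k"
      by unfold_locales (rule subalgG)
    show ?thesis
    proof (rule GN.real_cond_exp_charact)
      fix A assume A: "A \<in> sets (G k)"
      then have AH: "A \<in> sets H" using subalgG[of k] by (auto simp: subalgebra_def setsN)
      define B where "B = h -` A \<inter> space M"
      have B: "B \<in> sets (F k)" using measurable_sets[OF hF A] by (simp add: B_def spF)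
      have ind: "(\<lambda>y. indicator A y * \<zeta> i y) \<in> borel_measurable H"
        using \<zeta>H AH by auto
      have "(LINT y:A|N. \<zeta> i y) = (LINT x|M. indicator A (h x) * \<xi> i x)"
        unfolding set_lebesgue_integral_def using LINT[OF ind] by (simp add: \<zeta>h[OF ik(1)])
      also have "\<dots> = (LINT x:B|M. \<xi> i x)"
        unfolding set_lebesgue_integral_def
        by (rule Bochner_Integration.integral_cong) (auto simp: B_def indicator_def)
      also have "\<dots> = (LINT x:B|M. real_cond_exp M (F k) (\<xi> i) x)"
        by (rule FM.real_cond_exp_intA[OF int[OF ik(1)] B])
      also have "\<dots> = (LINT x|M. 0)"
        unfolding set_lebesgue_integral_def
      proof (rule integral_cong_AE)
        show "(\<lambda>x. indicat_real B x *\<^sub>R real_cond_exp M (F k) (\<xi> i) x) \<in> borel_measurable M"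
          using B sub[of k] by (intro borel_measurable_scaleR borel_measurable_indicator borel_measurable_cond_exp2) (auto simp: subalgebra_def)
      qed (use ce[OF ik] in auto)
      finally show "(LINT y:A|N. \<zeta> i y) = (LINT y:A|N. 0)" by (simp add: set_lebesgue_integral_def)
    qed (auto simp: intN[OF ik(1)])
  qed
  have G0: "sets (G 0) = {{}, UNIV}"
  proof
    show "sets (G 0) \<subseteq> {{}, UNIV}"
    proof
      fix A assume "A \<in> sets (G 0)"
      moreover have "sets (G 0) = {(\<lambda>y. restrict (g y) {1..0}) -` B \<inter> UNIV |B. B \<in> sets (P {1..0})}"
        unfolding G_def by (rule sets_vimage_algebra2) (auto simp: P_def space_PiM)
      ultimately obtain B where B: "B \<in> sets (P {1..0})" "A = (\<lambda>y. restrict (g y) {1..0}) -` B"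
        by auto
      from B(1) have "B \<subseteq> {\<lambda>_. undefined}" by (simp add: P_def PiM_empty)
      then have "B = {} \<or> B = {\<lambda>_. undefined}" by (simp add: subset_singleton_iff)
      with B(2) show "A \<in> {{}, UNIV}" by (auto simp: restrict_def)
    qed
    show "{{}, UNIV} \<subseteq> sets (G 0)" using sets.top[of "G 0"] spG[of 0] by auto
  qed
  have monoG: "sets (G i) \<subseteq> sets (G j)" if "i \<le> j" for i j
    by (rule subG) (use \<zeta>G spG that in auto)
  have mdsN: "centered_martingale_differences N G \<zeta>"
    unfolding centered_martingale_differences_def
  proof (intro conjI allI impI)
    show "filtration (space N) G" by (rule filtration.intro) (auto simp: spG spN dest: monoG)
    show "sets (G 0) = {{}, space N}" by (simp add: G0 spN)
    fix i :: nat assume i: "1 \<le> i"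
    show "(LINT y|N. \<zeta> i y) = 0" using LINT[OF \<zeta>H] mean[OF i] by (simp add: \<zeta>h[OF i])
    show "\<zeta> i \<in> borel_measurable (G i)" by (rule \<zeta>G[OF i]) simp
  qed (use subalgG intN ceN in auto)
  have LpN: "\<forall>i\<ge>1. \<zeta> i \<in> Lp_space N p"
  proof (intro allI impI)
    fix i :: nat assume i: "1 \<le> i"
    have "(\<lambda>y. \<bar>\<zeta> i y\<bar> powr p) \<in> borel_measurable H" using \<zeta>H[of i] by measurable
    from integ[OF this] Lp i \<zeta>N show "\<zeta> i \<in> Lp_space N p"
      by (auto simp: Lp_space_def \<zeta>h)
  qed
  have norm: "Lp_norm N p q = Lp_norm M p (\<lambda>x. q (h x))" if "q \<in> borel_measurable H" for q
  proof -
    have "(\<lambda>y. \<bar>q y\<bar> powr p) \<in> borel_measurable H" using that by measurable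
    from LINT[OF this] show ?thesis by (simp add: Lp_norm_def)
  qed
  have num: "numerator N p \<zeta> n = numerator M p \<xi> n" for n
  proof -
    have "(\<lambda>y. real n powr (- 1 / 2) * S \<zeta> n y) \<in> borel_measurable H"
      unfolding S_def using \<zeta>H by measurable
    from norm[OF this] show ?thesis by (simp add: numerator_def S_def \<zeta>h)
  qed
  have den: "denominator N p \<zeta> n = denominator M p \<xi> n" for n
    using norm[OF \<zeta>H] by (simp add: denominator_def \<zeta>h)
  show ?thesis by (rule that[OF probN mdsN LpN num den])
qed

lemma K_le_K:
  assumes "\<exists>f :: (nat \<Rightarrow> real) \<Rightarrow> 'a. inj f"
  shows "K TYPE('b) p \<le> K TYPE('a) p"
proof -
  obtain f :: "(nat \<Rightarrow> real) \<Rightarrow> 'a" where f: "inj f" using assms by blast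
  show ?thesis unfolding K_def
  proof (rule SUP_mono', rule Sup_subset_mono, safe)
    fix n and M :: "'b measure" and F \<xi>
    assume M: "prob_space M" "centered_martingale_differences M F \<xi>"
      "\<forall>i\<ge>1. \<xi> i \<in> Lp_space M p" and d: "denominator M p \<xi> n \<noteq> 0"
    obtain N :: "'a measure" and G and \<zeta> where
      "prob_space N" "centered_martingale_differences N G \<zeta>" "\<forall>i\<ge>1. \<zeta> i \<in> Lp_space N p"
      and "\<And>n. numerator N p \<zeta> n = numerator M p \<xi> n"
      and "\<And>n. denominator N p \<zeta> n = denominator M p \<xi> n"
      using martingale_differences_transfer[OF f M] by metis
    with d show "\<exists>N G \<zeta>. ereal (numerator M p \<xi> n / denominator M p \<xi> n) =
        ereal (numerator (N :: 'a measure) p \<zeta> n / denominator N p \<zeta> n) \<and>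
        prob_space N \<and> centered_martingale_differences N G \<zeta> \<and>
        (\<forall>i\<ge>1. \<zeta> i \<in> Lp_space N p) \<and> denominator N p \<zeta> n \<noteq> 0"
      by (intro exI[of _ N] exI[of _ G] exI[of _ \<zeta>]) auto
  qed
qed

end

theory Submission
  imports Defs
begin

text \<open>
  The upper bound is \<open>|S(n)|\<^sub>p\<^sup>2 \<le> (p - 1)\<^sup>2 \<Sum> |\<xi>(i)|\<^sub>p\<^sup>2\<close>. Its constant is weaker than the \<open>p - 1\<close>
  of Rio's inequality, but equal to it at \<open>p = 2\<close>, and it is weak enough to follow from the
  pointwise inequality
  \<open>|x + y|\<^sup>p \<le> p sgn(x) |x|\<^bsup>p - 1\<^esup> y + (x\<^sup>2 + (p - 1)\<^sup>2 y\<^sup>2)\<^bsup>p/2\<^esup>\<close>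
  (which fails with \<open>p - 1\<close> in place of \<open>(p - 1)\<^sup>2\<close> already for \<open>p = 4\<close>). For \<open>x = S(n)\<close> and \<open>y = \<xi>(n + 1)\<close> the first term
  has mean zero, and Minkowski's inequality in \<open>L(p/2)\<close> bounds the second one. A fair coin with
  \<open>n = 1\<close> gives \<open>K(2) \<ge> 1\<close>.
\<close>

section \<open>The pointwise inequality\<close>

lemma powr_above_tangent:
  fixes u w r :: real
  assumes "r \<ge> 1" "u > 0" "w \<ge> 0"
  shows "u powr r + r * u powr (r - 1) * (w - u) \<le> w powr r"
\<comment> \<open>Convexity and the derivative are used on the open half-line, so its endpoint is
  checked by hand.\<close>
proof (cases "w = 0")
  case True
  have "u powr r + r * u powr (r - 1) * (w - u) = (1 - r) * u powr r"
    using assms True by (simp add: powr_diff algebra_simps)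
  also have "\<dots> \<le> 0" using assms by (simp add: mult_nonpos_nonneg)
  finally show ?thesis using True by simp
next
  case False
  have "((\<lambda>x. x powr r) has_real_derivative r * u powr (r - 1)) (at u within {0<..})"
    using assms by (auto intro!: derivative_eq_intros)
  then show ?thesis
    using convex_on_imp_above_tangent[OF powr_convex[OF assms(1)], of u w] assms False
    by (fastforce simp: interior_open)
qed

lemma power2_powr_half: "(x\<^sup>2) powr (p / 2) = \<bar>x\<bar> powr p" for x :: real
proof -
  have "x\<^sup>2 = \<bar>x\<bar> powr 2" by (cases "x = 0") (auto simp: powr_numeral)
  then show ?thesis by (simp only: powr_powr) simp
qed

text \<open>The normalised case \<open>x = 1\<close> of \<open>abs_add_powr_le\<close>. Since
  \<open>p / 2\<close> is at least 1, the power on the right is convex and lies above each of its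
  tangents; two points of tangency suffice for all \<open>y\<close>.\<close>

lemma abs_one_plus_powr_le:
  fixes p y :: real
  assumes "p \<ge> 2"
  shows "\<bar>1 + y\<bar> powr p \<le> p * y + (1 + (p - 1)\<^sup>2 * y\<^sup>2) powr (p / 2)"
proof -
  define s r c w where "s = p - 2" and "r = p / 2" and "c = (p - 1)\<^sup>2" and "w = 1 + c * y\<^sup>2"
  have s: "s \<ge> 0" and r: "r \<ge> 1" and pr: "p = 2 * r" and ps: "p = s + 2"
    using assms by (auto simp: s_def r_def)
  have c: "c = 1 + s * (s + 2)" "c \<ge> 1" 
    using s by (auto simp: c_def s_def power2_eq_square algebra_simps)
  have w: "w \<ge> 0" using c by (simp add: w_def)
  have w1: "1 + r * (c * y\<^sup>2) \<le> w powr r"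
    using powr_above_tangent[OF r, of 1 w] w by (simp add: w_def)
  have goal: ?thesis if "\<bar>1 + y\<bar> powr p \<le> p * y + w powr r"
    using that by (simp add: w_def c_def r_def)
  \<comment> \<open>Since \<open>p = 2 * r\<close>, the factor \<open>r\<close> cancels between the
    linear term \<open>p * y\<close> and the slope of the tangent at \<open>(1 + y)^2\<close>;
    \<open>D\<close> is the condition that remains.\<close>
  have tangent: ?thesis if y: "1 + y \<noteq> 0" and D: "- 2 * y \<le> \<bar>1 + y\<bar> powr s * (s * (s + 2) * y\<^sup>2 - 2 * y)"
  proof -
    let ?u = "(1 + y)\<^sup>2"
    have "?u powr r + r * ?u powr (r - 1) * (w - ?u) \<le> w powr r"
      using y w by (intro powr_above_tangent r) auto
    moreover have "?u powr r = \<bar>1 + y\<bar> powr p" "?u powr (r - 1) = \<bar>1 + y\<bar> powr s"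
      using power2_powr_half[of "1 + y" p] power2_powr_half[of "1 + y" s]
      by (simp_all add: r_def s_def diff_divide_distrib)
    moreover have "w - ?u = s * (s + 2) * y\<^sup>2 - 2 * y"
      by (simp add: w_def c power2_eq_square algebra_simps)
    moreover have "r * (- 2 * y) \<le> r * (\<bar>1 + y\<bar> powr s * (s * (s + 2) * y\<^sup>2 - 2 * y))"
      using D r by (intro mult_left_mono) auto
    ultimately show ?thesis by (intro goal) (simp add: pr mult.assoc)
  qed
  txt \<open>
    The tangent of the power \<open>r\<close> at \<open>(1 + y)\<^sup>2\<close> (fact \<open>tangent\<close>) is too weak near \<open>y = -1\<close>, where it
    degenerates; there the tangent at \<open>1\<close> (fact \<open>w1\<close>) is used instead.
  \<close>
  consider "y \<ge> 0" | "-1 \<le> y" "y \<le> 0" | "-2 \<le> y" "y \<le> -1" | "y \<le> -2" by linarith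
  then show ?thesis
  proof cases
    case 1
    let ?q = "(1 + y) powr s"
    have q: "?q * (1 - s * y) \<le> 1"
    proof -
      have "?q \<le> exp y powr s" using 1 s by (intro powr_mono2) auto
      also have "\<dots> = exp (s * y)" by (simp add: powr_def)
      finally have "?q \<le> exp (s * y)" .
      moreover have "1 - s * y \<le> exp (- (s * y))" using exp_ge_add_one_self[of "- (s * y)"] by simp
      ultimately have "?q * (1 - s * y) \<le> exp (s * y) * exp (- (s * y))"
        by (smt (verit) mult_left_mono mult_right_mono powr_ge_zero exp_ge_zero)
      then show ?thesis by (simp flip: exp_add)
    qed
    \<comment> \<open>The split leaves a multiple of the quantity bounded in \<open>q\<close> and a
      nonnegative square.\<close>
    have "?q * (s * (s + 2) * y\<^sup>2 - 2 * y) = - 2 * y * (?q * (1 - s * y)) + ?q * (s * y)\<^sup>2"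
      by (simp add: power2_eq_square algebra_simps)
    moreover have "2 * y * (?q * (1 - s * y)) \<le> 2 * y * 1" using q 1 by (intro mult_left_mono) auto
    moreover have "?q * (s * y)\<^sup>2 \<ge> 0" by simp
    ultimately have "- 2 * y \<le> ?q * (s * (s + 2) * y\<^sup>2 - 2 * y)" by linarith
    then show ?thesis using 1 by (intro tangent) simp_all
  next
    case 2
    define z where "z = - y"
    have z: "0 \<le> z" "z \<le> 1" using 2 by (auto simp: z_def)
    have sz: "1 + s * z > 0" using s z by (smt (verit) mult_nonneg_nonneg)
    \<comment> \<open>The bounds \<open>1 - z <= exp (- z)\<close> and
      \<open>1 + s * z <= exp (s * z)\<close> replace the real power by a rational function.\<close>
    have "(1 - z) powr s \<le> exp (- z) powr s"
      using z s exp_ge_add_one_self[of "- z"] by (intro powr_mono2) auto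
    also have "\<dots> = inverse (exp (s * z))" by (simp add: powr_def flip: exp_minus)
    also have "\<dots> \<le> inverse (1 + s * z)"
      using sz exp_ge_add_one_self[of "s * z"] by (intro le_imp_inverse_le) auto
    finally have A: "(1 - z) powr s \<le> inverse (1 + s * z)" .
    have "\<bar>1 + y\<bar> powr p = (1 - z)\<^sup>2 * (1 - z) powr s"
      using z by (cases "z = 1") (auto simp: z_def ps powr_add powr_numeral)
    also have "\<dots> \<le> (1 - z)\<^sup>2 * inverse (1 + s * z)" using A by (intro mult_left_mono) auto
    also have "\<dots> \<le> 1 - p * z + r * c * z\<^sup>2"
    proof -
      \<comment> \<open>Multiplied by \<open>1 + s * z\<close> the claim is polynomial. Already with
        \<open>c\<close> in place of \<open>r * c\<close> the two sides differ by exactly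
        \<open>c * s * z ^ 3\<close>, which is nonnegative.\<close>
      have C: "r * c \<ge> c" using r c by simp
      have "(1 - z)\<^sup>2 = (1 - p * z + c * z\<^sup>2) * (1 + s * z) - c * s * z ^ 3"
        by (simp add: ps c(1) power2_eq_square power3_eq_cube algebra_simps)
      also have "\<dots> \<le> (1 - p * z + c * z\<^sup>2) * (1 + s * z)" using c s z by simp
      also have "\<dots> \<le> (1 - p * z + r * c * z\<^sup>2) * (1 + s * z)"
        using C sz by (intro mult_right_mono add_left_mono) auto
      finally show ?thesis using sz by (simp add: field_simps)
    qed
    finally show ?thesis using w1 by (intro goal) (simp add: z_def mult.assoc)
  next
    case 3
    \<comment> \<open>Here \<open>1 + y\<close> has absolute value at most 1, so the exponent can be
      lowered to 2 and only polynomials remain on the left.\<close>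
    have "\<bar>1 + y\<bar> powr p \<le> \<bar>1 + y\<bar> powr 2"
      using 3 assms by (intro powr_mono') auto
    also have "\<dots> = (1 + y)\<^sup>2" by (cases "y = -1") (auto simp: powr_numeral)
    also have "\<dots> = 1 + p * y + y\<^sup>2 + s * (- y)" by (simp add: ps power2_eq_square algebra_simps)
    also have "s * (- y) \<le> s * y\<^sup>2" using 3 s by (intro mult_left_mono) (use self_le_power[of "- y" 2] in auto)
    also have "1 + p * y + y\<^sup>2 + s * y\<^sup>2 = 1 + p * y + 1 * ((1 + s) * y\<^sup>2)" by (simp add: algebra_simps)
    also have "1 * ((1 + s) * y\<^sup>2) \<le> r * (c * y\<^sup>2)"
      using r s c by (intro mult_mono) (auto simp: algebra_simps intro!: mult_mono)
    finally show ?thesis using w1 by (intro goal) simp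
  next
    case 4
    have "1 * (- 2 * y) \<le> \<bar>1 + y\<bar> powr s * (s * (s + 2) * y\<^sup>2 - 2 * y)"
      using 4 s by (intro mult_mono ge_one_powr_ge_zero) auto
    then show ?thesis using 4 by (intro tangent) auto
  qed
qed

text \<open>Both sides are homogeneous of degree \<open>p\<close>, so a nonzero \<open>x\<close> can
  be scaled to 1. At \<open>x = 0\<close> the linear term vanishes and \<open>p - 1 >= 1\<close> is
  enough.\<close>

lemma abs_add_powr_le:
  fixes p x y :: real
  assumes "p \<ge> 2"
  shows "\<bar>x + y\<bar> powr p \<le> p * (sgn x * \<bar>x\<bar> powr (p - 1)) * y + (x\<^sup>2 + (p - 1)\<^sup>2 * y\<^sup>2) powr (p / 2)"
proof (cases "x = 0")
  case True
  have "y\<^sup>2 \<le> (p - 1)\<^sup>2 * y\<^sup>2"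
    using assms by (simp add: mult_le_cancel_right1 one_le_power)
  then have "(y\<^sup>2) powr (p / 2) \<le> ((p - 1)\<^sup>2 * y\<^sup>2) powr (p / 2)"
    using assms by (intro powr_mono2) auto
  with True show ?thesis by (simp add: power2_powr_half)
next
  case False
  let ?t = "y / x"
  have "\<bar>x + y\<bar> powr p = \<bar>x\<bar> powr p * \<bar>1 + ?t\<bar> powr p"
  proof -
    have "x + y = x * (1 + ?t)" using False by (simp add: field_simps)
    then show ?thesis by (simp only: abs_mult powr_mult)
  qed
  also have "\<dots> \<le> \<bar>x\<bar> powr p * (p * ?t + (1 + (p - 1)\<^sup>2 * ?t\<^sup>2) powr (p / 2))"
    by (intro mult_left_mono abs_one_plus_powr_le assms) auto
  also have "\<dots> = p * (\<bar>x\<bar> powr p / x) * y + (x\<^sup>2 * (1 + (p - 1)\<^sup>2 * ?t\<^sup>2)) powr (p / 2)"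
    by (simp only: powr_mult power2_powr_half) (simp add: distrib_left)
  also have "x\<^sup>2 * (1 + (p - 1)\<^sup>2 * ?t\<^sup>2) = x\<^sup>2 + (p - 1)\<^sup>2 * y\<^sup>2"
    using False by (simp add: power_divide field_simps)
  also have "\<bar>x\<bar> powr p / x = sgn x * \<bar>x\<bar> powr (p - 1)"
    using False by (simp add: powr_diff sgn_if field_simps)
  finally show ?thesis .
qed

section \<open>Minkowski's inequality\<close>

text \<open>Jensen's inequality for the points \<open>x / a\<close> and \<open>y / b\<close> with
  weights proportional to \<open>a\<close> and \<open>b\<close>. The weights stay free so that they
  can later be chosen close to the two norms.\<close>

lemma powr_add_le_weighted:
  fixes a b x y r :: real
  assumes "r \<ge> 1" "a > 0" "b > 0" "x \<ge> 0" "y \<ge> 0"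
  shows "(x + y) powr r \<le> (a + b) powr (r - 1) * (a powr (1 - r) * x powr r + b powr (1 - r) * y powr r)"
proof (cases "x + y = 0")
  case True
  then show ?thesis by simp
next
  case False
  define m where "m = (x + y) / (a + b)"
  have m: "m > 0" using assms False by (simp add: m_def)
  have e: "c * (z / c) powr r = c powr (1 - r) * z powr r" if "c > 0" for c z
    using that by (simp add: powr_divide powr_diff)
  \<comment> \<open>\<open>m\<close> is the weighted mean of \<open>x / a\<close> and
    \<open>y / b\<close>, so the linear terms of the two tangents at \<open>m\<close>
    cancel.\<close>
  have "(a + b) * m powr r = a * (m powr r + r * m powr (r - 1) * (x / a - m))
      + b * (m powr r + r * m powr (r - 1) * (y / b - m))"
  proof -
    have "a * (x / a - m) + b * (y / b - m) = x + y - (a + b) * m"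
      using assms by (simp add: algebra_simps)
    moreover have "(a + b) * m = x + y" using assms by (simp add: m_def)
    ultimately have "a * (x / a - m) + b * (y / b - m) = 0" by simp
    then show ?thesis by algebra
  qed
  also have "\<dots> \<le> a * (x / a) powr r + b * (y / b) powr r"
    using assms m by (intro add_mono mult_left_mono powr_above_tangent) auto
  also have "\<dots> = a powr (1 - r) * x powr r + b powr (1 - r) * y powr r" using e assms by simp
  finally have "(a + b) powr (r - 1) * ((a + b) * m powr r) \<le>
      (a + b) powr (r - 1) * (a powr (1 - r) * x powr r + b powr (1 - r) * y powr r)"
    by (intro mult_left_mono) auto
  also have "(a + b) powr (r - 1) * ((a + b) * m powr r) = (x + y) powr r"
    using assms by (simp add: m_def powr_divide powr_diff)
  finally show ?thesis .
qed

text \<open>The bound of \<open>powr_add_le_weighted\<close> is linear in the powers of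
  \<open>f\<close> and \<open>g\<close>, so it can be integrated with constant weights. Weights near
  the norms make the bracket at most \<open>a + b\<close>, and the whole bound
  \<open>(a + b) powr r\<close>.\<close>

lemma
  fixes f g :: "'a \<Rightarrow> real"
  assumes r: "r \<ge> 1"
    and [measurable]: "f \<in> borel_measurable M" "g \<in> borel_measurable M"
    and nonneg: "\<And>x. f x \<ge> 0" "\<And>x. g x \<ge> 0"
    and int: "integrable M (\<lambda>x. f x powr r)" "integrable M (\<lambda>x. g x powr r)"
  shows integrable_powr_add: "integrable M (\<lambda>x. (f x + g x) powr r)"
    and Minkowski_inequality: "(LINT x|M. (f x + g x) powr r) powr (1 / r) \<le>
      (LINT x|M. f x powr r) powr (1 / r) + (LINT x|M. g x powr r) powr (1 / r)"
proof -
  show I: "integrable M (\<lambda>x. (f x + g x) powr r)"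
  proof (rule Bochner_Integration.integrable_bound)
    show "integrable M (\<lambda>x. 2 powr (r - 1) * (f x powr r + g x powr r))" using int by simp
    show "AE x in M. norm ((f x + g x) powr r) \<le> norm (2 powr (r - 1) * (f x powr r + g x powr r))"
      using powr_add_le_weighted[OF r, of 1 1] nonneg by simp
  qed measurable
  let ?a = "(LINT x|M. f x powr r) powr (1 / r)" and ?b = "(LINT x|M. g x powr r) powr (1 / r)"
  show "(LINT x|M. (f x + g x) powr r) powr (1 / r) \<le> ?a + ?b"
  proof (rule field_le_epsilon)
    fix e :: real assume e: "e > 0"
    \<comment> \<open>The shift by \<open>e / 2\<close> keeps the weights positive when one of the norms is zero.\<close>
    define a b where "a = ?a + e / 2" and "b = ?b + e / 2"
    have ab: "a > 0" "b > 0" using e by (auto simp: a_def b_def add_nonneg_pos)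
    have normalise: "c powr (1 - r) * J \<le> c" if "J \<ge> 0" "c = J powr (1 / r) + e / 2" for c J
    proof -
      have c: "c > 0" using that e by (auto simp: add_nonneg_pos)
      have "J = (J powr (1 / r)) powr r" using that r by (simp add: powr_powr)
      also have "\<dots> \<le> c powr r" using that r e by (intro powr_mono2) auto
      finally have "c powr (1 - r) * J \<le> c powr (1 - r) * c powr r" by (intro mult_left_mono) auto
      then show ?thesis using c by (simp flip: powr_add)
    qed
    have "(LINT x|M. (f x + g x) powr r) \<le> (LINT x|M. (a + b) powr (r - 1) *
        (a powr (1 - r) * f x powr r + b powr (1 - r) * g x powr r))"
      using I int nonneg ab by (intro integral_mono powr_add_le_weighted r) auto
    also have "\<dots> = (a + b) powr (r - 1) *
        (a powr (1 - r) * (LINT x|M. f x powr r) + b powr (1 - r) * (LINT x|M. g x powr r))"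
      using int by simp
    also have "\<dots> \<le> (a + b) powr (r - 1) * (a + b)"
      by (intro mult_left_mono add_mono normalise) (auto simp: a_def b_def)
    also have "\<dots> = (a + b) powr r" using ab by (simp add: powr_diff)
    finally have "(LINT x|M. (f x + g x) powr r) powr (1 / r) \<le> ((a + b) powr r) powr (1 / r)"
      using r by (intro powr_mono2) auto
    also have "\<dots> = a + b" using r ab by (simp add: powr_powr)
    finally show "(LINT x|M. (f x + g x) powr r) powr (1 / r) \<le> ?a + ?b + e"
      by (simp add: a_def b_def)
  qed
qed

section \<open>The upper bound for martingales\<close>

lemma Lp_space_add:
  assumes p: "p \<ge> 1" and X: "X \<in> Lp_space M p" and Y: "Y \<in> Lp_space M p"
  shows "(\<lambda>x. X x + Y x) \<in> Lp_space M p"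
proof -
  have [measurable]: "X \<in> borel_measurable M" "Y \<in> borel_measurable M"
    using X Y by (auto simp: Lp_space_def)
  have "integrable M (\<lambda>x. (\<bar>X x\<bar> + \<bar>Y x\<bar>) powr p)"
    using X Y by (intro integrable_powr_add p) (auto simp: Lp_space_def)
  then have "integrable M (\<lambda>x. \<bar>X x + Y x\<bar> powr p)"
    by (rule Bochner_Integration.integrable_bound) (use p in \<open>auto intro!: powr_mono2\<close>)
  then show ?thesis by (simp add: Lp_space_def)
qed

lemma Lp_norm_cmult:
  assumes "p > 0"
  shows "Lp_norm M p (\<lambda>x. c * X x) = \<bar>c\<bar> * Lp_norm M p X"
  using assms by (simp add: Lp_norm_def abs_mult powr_mult powr_powr)

text \<open>This is the form in which \<open>Minkowski_inequality\<close> applies, with exponent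
  \<open>p / 2\<close>.\<close>

lemma Lp_norm_square: "(Lp_norm M p X)\<^sup>2 = (LINT x|M. ((X x)\<^sup>2) powr (p / 2)) powr (1 / (p / 2))"
  unfolding power2_powr_half Lp_norm_def by (simp add: power2_eq_square flip: powr_add)

lemma (in finite_measure_subalgebra) Lp_norm_add_martingale_difference:
  assumes p: "p \<ge> 2"
    and X: "X \<in> Lp_space M p" "X \<in> borel_measurable F"
    and Y: "Y \<in> Lp_space M p" "AE x in M. real_cond_exp M F Y x = 0"
  shows "(Lp_norm M p (\<lambda>x. X x + Y x))\<^sup>2 \<le> (Lp_norm M p X)\<^sup>2 + (p - 1)\<^sup>2 * (Lp_norm M p Y)\<^sup>2"
proof -
  define c r D where "c = (p - 1)\<^sup>2" and "r = p / 2"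
    and "D = (\<lambda>x. sgn (X x) * \<bar>X x\<bar> powr (p - 1))"
  have c: "c \<ge> 0" and r: "r \<ge> 1" using p by (auto simp: c_def r_def)
  have [measurable]: "X \<in> borel_measurable M" "Y \<in> borel_measurable M"
    and int: "integrable M (\<lambda>x. \<bar>X x\<bar> powr p)" "integrable M (\<lambda>x. \<bar>Y x\<bar> powr p)"
    using X Y by (auto simp: Lp_space_def)
  have DF: "D \<in> borel_measurable F" unfolding D_def using X(2) by measurable
  have [measurable]: "D \<in> borel_measurable M" by (rule measurable_from_subalg[OF subalg DF])
  have DY: "integrable M (\<lambda>x. D x * Y x)"
  proof (rule Bochner_Integration.integrable_bound)
    show "integrable M (\<lambda>x. \<bar>X x\<bar> powr p + \<bar>Y x\<bar> powr p)" using int by simp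
    show "AE x in M. norm (D x * Y x) \<le> norm (\<bar>X x\<bar> powr p + \<bar>Y x\<bar> powr p)"
    proof (intro AE_I2)
      fix x
      \<comment> \<open>Replacing both absolute values by their maximum turns the product into
        \<open>m powr p\<close>, which is one of the two summands of the integrable bound.\<close>
      define m where "m = max \<bar>X x\<bar> \<bar>Y x\<bar>"
      have "\<bar>D x * Y x\<bar> \<le> \<bar>X x\<bar> powr (p - 1) * \<bar>Y x\<bar>"
        by (simp add: D_def abs_mult sgn_if)
      also have "\<dots> \<le> m powr (p - 1) * m"
        using p by (intro mult_mono powr_mono2) (auto simp: m_def)
      also have "\<dots> = m powr p" by (auto simp: powr_diff m_def)
      also have "\<dots> \<le> \<bar>X x\<bar> powr p + \<bar>Y x\<bar> powr p" by (auto simp: m_def max_def)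
      finally show "norm (D x * Y x) \<le> norm (\<bar>X x\<bar> powr p + \<bar>Y x\<bar> powr p)" by simp
    qed
  qed measurable
  \<comment> \<open>As \<open>D\<close> is measurable with respect to \<open>F\<close>,
    \<open>Y\<close> may be replaced by its conditional expectation, which is zero.\<close>
  have "(LINT x|M. D x * Y x) = (LINT x|M. D x * real_cond_exp M F Y x)"
    by (rule real_cond_exp_intg(2)[OF DY DF, symmetric]) simp
  also have "\<dots> = (LINT x|M. 0)"
    by (rule integral_cong_AE) (use Y(2) in auto)
  finally have DY0: "(LINT x|M. D x * Y x) = 0" by simp
  have cY: "(c * (Y x)\<^sup>2) powr r = c powr r * \<bar>Y x\<bar> powr p" for x
    by (simp add: powr_mult r_def power2_powr_half)
  have iX: "integrable M (\<lambda>x. (X x)\<^sup>2 powr r)" and iY: "integrable M (\<lambda>x. (c * (Y x)\<^sup>2) powr r)"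
    using int by (simp_all add: cY) (simp add: r_def power2_powr_half)
  have iXY: "integrable M (\<lambda>x. ((X x)\<^sup>2 + c * (Y x)\<^sup>2) powr r)"
    using c r iX iY by (intro integrable_powr_add) auto
  have "integrable M (\<lambda>x. \<bar>X x + Y x\<bar> powr p)"
    using Lp_space_add[OF _ X(1) Y(1)] p by (simp add: Lp_space_def)
  then have "(LINT x|M. \<bar>X x + Y x\<bar> powr p) \<le>
      (LINT x|M. p * (D x * Y x) + ((X x)\<^sup>2 + c * (Y x)\<^sup>2) powr r)"
    using DY iXY abs_add_powr_le[OF p]
    by (intro integral_mono) (auto simp: D_def c_def r_def mult.assoc)
  also have "\<dots> = (LINT x|M. ((X x)\<^sup>2 + c * (Y x)\<^sup>2) powr r)"
    using DY iXY by (simp add: DY0)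
  finally have "(Lp_norm M p (\<lambda>x. X x + Y x))\<^sup>2 \<le> (LINT x|M. ((X x)\<^sup>2 + c * (Y x)\<^sup>2) powr r) powr (1 / r)"
    unfolding Lp_norm_square power2_powr_half using p by (auto simp: r_def intro!: powr_mono2)
  also have "\<dots> \<le> (LINT x|M. (X x)\<^sup>2 powr r) powr (1 / r) + (LINT x|M. (c * (Y x)\<^sup>2) powr r) powr (1 / r)"
    using c r iX iY by (intro Minkowski_inequality) auto
  also have "\<dots> = (Lp_norm M p X)\<^sup>2 + c * (Lp_norm M p Y)\<^sup>2"
    using c r unfolding cY Lp_norm_square power2_powr_half r_def[symmetric]
    by (simp add: powr_mult powr_powr) (simp add: r_def power2_powr_half)
  finally show ?thesis by (simp add: c_def)
qed

lemma Lp_norm_martingale: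
  assumes p: "p \<ge> 2" and M: "prob_space M"
    and mds: "centered_martingale_differences M F \<xi>"
    and Lp: "\<forall>i\<ge>1. \<xi> i \<in> Lp_space M p"
  shows "(Lp_norm M p (S \<xi> n))\<^sup>2 \<le> (p - 1)\<^sup>2 * (\<Sum>i=1..n. (Lp_norm M p (\<xi> i))\<^sup>2)"
proof -
  interpret prob_space M by (rule M)
  have filt: "filtration (space M) F" and sub: "\<And>i. subalgebra M (F i)"
    and adapt: "\<And>i. i \<ge> 1 \<Longrightarrow> \<xi> i \<in> borel_measurable (F i)"
    and ce: "\<And>i k. i \<ge> 1 \<Longrightarrow> k \<le> i - 1 \<Longrightarrow> AE x in M. real_cond_exp M (F k) (\<xi> i) x = 0"
    using mds unfolding centered_martingale_differences_def by auto
  have subF: "subalgebra (F j) (F i)" if "i \<le> j" for i j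
    using filtration.sets_F_mono[OF filt that] sub by (simp add: subalgebra_def)
  have SF: "S \<xi> n \<in> borel_measurable (F n)" for n
    unfolding S_def using measurable_from_subalg[OF subF adapt]
    by (intro borel_measurable_sum) auto
  have S_Suc: "S \<xi> (Suc n) = (\<lambda>x. S \<xi> n x + \<xi> (Suc n) x)" for n
    by (simp add: S_def fun_eq_iff)
  have SLp: "S \<xi> n \<in> Lp_space M p" for n
  proof (induction n)
    case 0
    then show ?case by (simp add: Lp_space_def S_def)
  next
    case (Suc n)
    then show ?case unfolding S_Suc using p Lp by (intro Lp_space_add) auto
  qed
  show ?thesis
  proof (induction n)
    case 0
    then show ?case by (simp add: Lp_norm_def S_def)
  next
    case (Suc n)
    \<comment> \<open>\<open>F n\<close> makes \<open>S \<xi> n\<close> measurable, and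
      \<open>n\<close> is the last index at which \<open>\<xi> (Suc n)\<close> is known to have
      conditional mean zero.\<close>
    interpret finite_measure_subalgebra M "F n" by unfold_locales (rule sub)
    have "(Lp_norm M p (S \<xi> (Suc n)))\<^sup>2 \<le>
        (Lp_norm M p (S \<xi> n))\<^sup>2 + (p - 1)\<^sup>2 * (Lp_norm M p (\<xi> (Suc n)))\<^sup>2"
      unfolding S_Suc using p Lp SLp SF ce by (intro Lp_norm_add_martingale_difference) auto
    with Suc.IH show ?case by (simp add: distrib_left)
  qed
qed

lemma numerator_le_denominator:
  assumes p: "p \<ge> 2" and M: "prob_space M"
    and mds: "centered_martingale_differences M F \<xi>"
    and Lp: "\<forall>i\<ge>1. \<xi> i \<in> Lp_space M p"
  shows "numerator M p \<xi> n \<le> (p - 1) * denominator M p \<xi> n"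
proof (rule power2_le_imp_le)
  have "(numerator M p \<xi> n)\<^sup>2 = (real n powr (- 1 / 2))\<^sup>2 * (Lp_norm M p (S \<xi> n))\<^sup>2"
    using p by (simp add: numerator_def Lp_norm_cmult power_mult_distrib)
  \<comment> \<open>At \<open>n = 0\<close> both sides are 0, by the conventions for
    \<open>powr\<close> and division at zero.\<close>
  also have "(real n powr (- 1 / 2))\<^sup>2 = 1 / real n"
    by (cases "n = 0") (auto simp: powr_power powr_minus divide_simps)
  also have "1 / real n * (Lp_norm M p (S \<xi> n))\<^sup>2 \<le>
      1 / real n * ((p - 1)\<^sup>2 * (\<Sum>i=1..n. (Lp_norm M p (\<xi> i))\<^sup>2))"
    by (intro mult_left_mono Lp_norm_martingale[OF assms]) auto
  also have "\<dots> = ((p - 1) * denominator M p \<xi> n)\<^sup>2"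
    by (simp add: denominator_def power_mult_distrib sum_nonneg)
  finally show "(numerator M p \<xi> n)\<^sup>2 \<le> ((p - 1) * denominator M p \<xi> n)\<^sup>2" .
  show "0 \<le> (p - 1) * denominator M p \<xi> n"
    using p by (simp add: denominator_def sum_nonneg)
qed

lemma K_le:
  assumes "p \<ge> 2"
  shows "K TYPE('a) p \<le> ereal (p - 1)"
  unfolding K_def
proof (rule SUP_least, rule Sup_least, elim CollectE exE conjE, hypsubst)
  fix n and M :: "'a measure" and F \<xi>
  assume *: "prob_space M" "centered_martingale_differences M F \<xi>" "\<forall>i\<ge>1. \<xi> i \<in> Lp_space M p"
    and d: "denominator M p \<xi> n \<noteq> 0"
  have "denominator M p \<xi> n \<ge> 0" by (simp add: denominator_def sum_nonneg)
  with d have "denominator M p \<xi> n > 0" by linarith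
  then show "ereal (numerator M p \<xi> n / denominator M p \<xi> n) \<le> ereal (p - 1)"
    using numerator_le_denominator[OF assms *, of n] by (simp add: pos_divide_le_eq)
qed

section \<open>The lower bound and the conclusion\<close>

lemma K_bool_2_ge: "1 \<le> K TYPE(bool) 2"
proof -
  define M where "M = measure_pmf (bernoulli_pmf (1 / 2))"
  \<comment> \<open>Everything is revealed at time 1: \<open>F 0\<close> is trivial, and all
    differences after the single coin toss are zero.\<close>
  define F :: "nat \<Rightarrow> bool measure" where "F = (\<lambda>i. if i = 0 then sigma UNIV {} else M)"
  define \<xi> :: "nat \<Rightarrow> bool \<Rightarrow> real" where "\<xi> = (\<lambda>i x. if i = 1 then if x then 1 else - 1 else 0)"
  have M: "prob_space M" by (simp add: M_def measure_pmf.prob_space_axioms)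
  then interpret prob_space M .
  have F0: "sets (F 0) = {{}, UNIV}" by (simp add: F_def sigma_sets_empty_eq)
  have sub: "subalgebra M (F i)" for i
    by (auto simp: subalgebra_def F_def M_def)
  have int: "integrable M f" for f :: "bool \<Rightarrow> real"
    unfolding M_def by (rule integrable_measure_pmf_finite) simp
  have LINT: "(LINT x|M. f x) = (f True + f False) / 2" for f :: "bool \<Rightarrow> real"
    unfolding M_def by simp
  have ce: "AE x in M. real_cond_exp M (F k) (\<xi> i) x = 0" if i: "i \<ge> 1" "k \<le> i - 1" for i k
  proof -
    interpret finite_measure_subalgebra M "F k" by unfold_locales (rule sub)
    show ?thesis
    proof (rule real_cond_exp_charact)
      fix A assume A: "A \<in> sets (F k)"
      show "(LINT x:A|M. \<xi> i x) = (LINT x:A|M. 0)"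
      proof (cases "i = 1")
        case True
        \<comment> \<open>For \<open>i = 1\<close> the only admissible \<open>k\<close> is 0, so
          \<open>A\<close> is a trivial event and the coin has mean zero on it.\<close>
        with i A F0 have "A = {} \<or> A = UNIV" by auto
        then show ?thesis by (auto simp: set_lebesgue_integral_def LINT \<xi>_def True)
      qed (simp add: \<xi>_def)
    qed (auto simp: int)
  qed
  have mds: "centered_martingale_differences M F \<xi>"
    unfolding centered_martingale_differences_def
  proof (intro conjI allI impI)
    show "filtration (space M) F"
      by (rule filtration.intro) (auto simp: F_def M_def)
    show "sets (F 0) = {{}, space M}" by (simp add: F0 M_def)
    show "\<xi> i \<in> borel_measurable (F i)" if "i \<ge> 1" for i
      using that by (simp add: F_def M_def)
    show "(LINT x|M. \<xi> i x) = 0" for i by (simp add: LINT \<xi>_def)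
  qed (use sub int ce in auto)
  have Lp: "\<xi> i \<in> Lp_space M p" for i p
    by (simp add: Lp_space_def int) (simp add: M_def)
  have num: "numerator M 2 \<xi> 1 = 1" and den: "denominator M 2 \<xi> 1 = 1"
    by (simp_all add: numerator_def denominator_def Lp_norm_def S_def LINT \<xi>_def)
  have "1 \<le> Sup {ereal (numerator M 2 \<xi> 1 / denominator M 2 \<xi> 1) | (M :: bool measure) F \<xi>.
     prob_space M \<and> centered_martingale_differences M F \<xi> \<and>
     (\<forall>i\<ge>1. \<xi> i \<in> Lp_space M 2) \<and> denominator M 2 \<xi> 1 \<noteq> 0}"
    using M mds Lp num den
    by (intro Sup_upper CollectI exI[of _ M] exI[of _ F] exI[of _ \<xi>]) (auto simp: one_ereal_def)
  also have "\<dots> \<le> K TYPE(bool) 2"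
    unfolding K_def by (rule SUP_upper) simp
  finally show ?thesis .
qed

theorem theorem3p1:
  assumes "\<exists>f :: (nat \<Rightarrow> real) \<Rightarrow> 'a. inj f"
  shows "(SUP p\<in>{2..}. K TYPE('a) p / ereal (p - 1)) = 1"
proof (rule antisym)
  show "(SUP p\<in>{2..}. K TYPE('a) p / ereal (p - 1)) \<le> 1"
  proof (rule SUP_least)
    fix p :: real assume "p \<in> {2..}"
    then show "K TYPE('a) p / ereal (p - 1) \<le> 1"
      using K_le[of p] by (simp add: ereal_divide_le_pos)
  qed
  \<comment> \<open>The injection carries the coin from \<open>bool\<close> to \<open>'a\<close>. At
    \<open>p = 2\<close> the divisor \<open>p - 1\<close> is 1, so the supremum is attained
    there.\<close>
  have "1 \<le> K TYPE('a) 2"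
    using K_bool_2_ge K_le_K[OF assms] by (rule order_trans)
  also have "\<dots> = K TYPE('a) 2 / ereal (2 - 1)"
    by (simp flip: one_ereal_def)
  also have "\<dots> \<le> (SUP p\<in>{2..}. K TYPE('a) p / ereal (p - 1))"
    by (rule SUP_upper) simp
  finally show "1 \<le> (SUP p\<in>{2..}. K TYPE('a) p / ereal (p - 1))" .
qed

end
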